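(* Let $N$ and $p$ be integers such that $1 \le p < \frac{N}{2}$, and let $m$ be the largest integer such that $2^{m} \le \min(N-2p, 2p)$. Then $$Q(N,p,=) \le N+1-m - \left \lfloor \frac{N+2-2^m}{p+1} \right \rfloor.$$
   Context: There are $N$ balls $b_1,\dots,b_N$, each colored red or green, with strictly fewer green than red balls (a Red-green coloring). For an integer $0\le p<\frac N2$, the coloring is $p$-equal if exactly $p$ balls are green. A comparison consists of choosing two balls and being told whether or not they have the same color (only "same" or "different" is answered). A method is an adaptive deterministic strategy: each comparison may depend on the answers to the previous ones. $Q(N,p,=)$ is the minimum integer $k$ such that there exists a method which, for every $p$-equal Red-green coloring of the $N$ balls (it being known in advance that the coloring is $p$-equal), determines for sure the color of every ball after at most $k$ comparisons. *)

theory Defs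
  imports Complex_Main
begin

text \<open>
  The balls are the numbers \<open>1, \<dots>, N\<close>. Values of a coloring outside \<open>{1..N}\<close> are irrelevant:
  they are neither counted, nor compared, nor required to be announced correctly.
\<close>

datatype color = Red | Green

type_synonym coloring = "nat \<Rightarrow> color"

definition p_equal :: "nat \<Rightarrow> nat \<Rightarrow> coloring \<Rightarrow> bool" where
  "p_equal N p c \<longleftrightarrow> card {i \<in> {1..N}. c i = Green} = p"

text \<open>
  An adaptive deterministic strategy is a binary decision tree. \<open>Compare i j s d\<close> compares the
  balls \<open>i\<close> and \<open>j\<close> and continues with \<open>s\<close> on the answer ``same'' and with \<open>d\<close> on
  the answer ``different''; \<open>Announce a\<close> stops and declares the coloring to be \<open>a\<close>.
\<close>

datatype strategy = Announce coloring | Compare nat nat strategy strategy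

primrec valid_strategy :: "nat \<Rightarrow> strategy \<Rightarrow> bool" where
  "valid_strategy N (Announce a) \<longleftrightarrow> True"
| "valid_strategy N (Compare i j s d) \<longleftrightarrow>
     i \<in> {1..N} \<and> j \<in> {1..N} \<and> i \<noteq> j \<and> valid_strategy N s \<and> valid_strategy N d"

primrec announced :: "strategy \<Rightarrow> coloring \<Rightarrow> coloring" where
  "announced (Announce a) c = a"
| "announced (Compare i j s d) c = (if c i = c j then announced s c else announced d c)"

primrec comparisons :: "strategy \<Rightarrow> coloring \<Rightarrow> nat" where
  "comparisons (Announce a) c = 0"
| "comparisons (Compare i j s d) c =
     Suc (if c i = c j then comparisons s c else comparisons d c)"

definition solves :: "nat \<Rightarrow> nat \<Rightarrow> nat \<Rightarrow> strategy \<Rightarrow> bool" where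
  "solves N p k t \<longleftrightarrow> valid_strategy N t \<and>
     (\<forall>c. p_equal N p c \<longrightarrow> (\<forall>i\<in>{1..N}. announced t c i = c i) \<and> comparisons t c \<le> k)"

text \<open>
  For \<open>2 * p < N\<close> the minimum is attained: comparing ball \<open>1\<close> with every other ball
  determines the color classes, and the class of size \<open>p\<close> is the green one.
\<close>

definition Q_equal :: "nat \<Rightarrow> nat \<Rightarrow> nat" where
  "Q_equal N p = (LEAST k. \<exists>t. solves N p k t)"

end

theory Submission
  imports Defs "HOL-Library.Nat_Bijection"
begin

text \<open>
  Treat each comparison as an edge between two balls. The comparisons made form a forest, and
  within a component the coloring is known up to exchanging the two colors. If the forest ends
  with \<open>T\<close> components, then \<open>N - T\<close> comparisons were used; so the aim is to finish with as many
  components as possible although every component has to be oriented. Put \<open>D = N - 2 * p\<close>, the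
  known excess of red over green. The bound of the theorem is \<open>N - T\<close> with
  \<open>T = m + 1 + (D - 2 ^ m) div (p + 1)\<close>.

  The balls are taken in order and each either joins the current component, by one comparison, or
  opens a new one for free. All that matters of a component is its excess \<open>d\<close>, the number of balls
  in its majority color minus the number of those in its minority color. A ball that differs from
  the majority lowers \<open>d\<close> by one and exhibits one more certain green ball, namely half of a pair
  of opposite colors. Discarding the \<open>b\<close> pairs found so far leaves a problem with the same \<open>D\<close> and
  with \<open>p' = p - b\<close> green balls. There are two ways to orient a component without connecting it to
  the others.

  \<^item> By counting at the end. If components of excess \<open>1, 2, 4, \<dots>, 2 ^ (j - 1)\<close> are the only ones
    left undetermined, the total number of green balls is known and so is, by uniqueness of binary
    expansions, the set of those components whose majority is green
    (lemma \<open>solvable_with_red_ball\<close>).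
  \<^item> By size. A component of excess \<open>p' + 1\<close> has a red majority, as otherwise there would be more
    than \<open>p\<close> green balls (lemma \<open>knowledge_majority_red\<close>).

  The method builds components of the first kind while \<open>2 ^ (j + 1) \<le> D\<close> and \<open>2 ^ j \<le> p'\<close>, and
  afterwards components of the second kind while there are enough balls; the remaining balls are
  compared with a red one. In the second phase a discarded pair never reduces the number of
  components, since \<open>(E - 1) div (P - 1) \<ge> E div P\<close> for \<open>E \<ge> P > 1\<close>
  (lemma \<open>solvable_by_red_components\<close>). In the first phase discarded pairs may shrink \<open>p'\<close> so much
  that fewer than \<open>m\<close> powers of two are completed, but then the components of the second kind are
  so small that their number makes up for the loss (lemma \<open>red_components_suffice\<close>).
\<close>

section \<open>Strategies as refinement of knowledge\<close>

text \<open>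
  Here \<open>S\<close> is the set of colorings that the answers so far leave possible, so strategies can be
  constructed backwards by splitting \<open>S\<close>, without ever being written down. The budget is an
  integer so that its bookkeeping needs no truncated subtraction.
\<close>

definition solvable :: "nat \<Rightarrow> coloring set \<Rightarrow> int \<Rightarrow> bool" where
  "solvable N S k \<longleftrightarrow> (\<exists>t. valid_strategy N t \<and>
     (\<forall>c\<in>S. (\<forall>i\<in>{1..N}. announced t c i = c i) \<and> int (comparisons t c) \<le> k))"

lemma solvable_if_determined:
  assumes "\<And>c c' i. c \<in> S \<Longrightarrow> c' \<in> S \<Longrightarrow> i \<in> {1..N} \<Longrightarrow> c i = c' i"
  shows "solvable N S 0"
proof (cases "S = {}")
  case True
  then show ?thesis
    unfolding solvable_def by (intro exI[of _ "Announce (\<lambda>_. Red)"]) simp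
next
  case False
  then obtain a where "a \<in> S" by blast
  then show ?thesis
    unfolding solvable_def using assms by (intro exI[of _ "Announce a"]) simp
qed

lemma solvable_compare:
  assumes "i \<in> {1..N}" "j \<in> {1..N}" "i \<noteq> j"
    and same: "solvable N {c \<in> S. c i = c j} (k - 1)"
    and diff: "solvable N {c \<in> S. c i \<noteq> c j} (k - 1)"
  shows "solvable N S k"
proof -
  obtain s where s: "valid_strategy N s"
    "\<And>c. c \<in> S \<Longrightarrow> c i = c j \<Longrightarrow>
      (\<forall>x\<in>{1..N}. announced s c x = c x) \<and> int (comparisons s c) \<le> k - 1"
    using same unfolding solvable_def by blast
  obtain d where d: "valid_strategy N d"
    "\<And>c. c \<in> S \<Longrightarrow> c i \<noteq> c j \<Longrightarrow>
      (\<forall>x\<in>{1..N}. announced d c x = c x) \<and> int (comparisons d c) \<le> k - 1"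
    using diff unfolding solvable_def by blast
  show ?thesis
    unfolding solvable_def
  proof (intro exI[of _ "Compare i j s d"] conjI ballI)
    show "valid_strategy N (Compare i j s d)" using assms(1-3) s(1) d(1) by simp
  next
    fix c x assume "c \<in> S" "x \<in> {1..N}"
    then show "announced (Compare i j s d) c x = c x" using s(2)[of c] d(2)[of c] by simp
  next
    fix c assume "c \<in> S"
    then show "int (comparisons (Compare i j s d) c) \<le> k"
      using s(2)[of c] d(2)[of c] by (cases "c i = c j") auto
  qed
qed

definition greens :: "nat \<Rightarrow> coloring \<Rightarrow> nat" where
  "greens q c = card {i \<in> {1..q}. c i = Green}"

lemma greens_Suc: "greens (Suc q) c = greens q c + (if c (Suc q) = Green then 1 else 0)"
proof -
  have "{i \<in> {1..Suc q}. c i = Green} =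
    (if c (Suc q) = Green then insert (Suc q) {i \<in> {1..q}. c i = Green}
     else {i \<in> {1..q}. c i = Green})"
    by (auto simp: le_Suc_eq)
  then show ?thesis by (simp add: greens_def)
qed

lemma greens_mono: "q \<le> q' \<Longrightarrow> greens q c \<le> greens q' c"
  unfolding greens_def by (rule card_mono) auto

section \<open>Knowledge about a forest of comparisons\<close>

text \<open>
  What the method remembers after processing the balls \<open>1, \<dots>, q\<close>. For \<open>i < j\<close> the ball \<open>u i\<close> lies
  in the majority of a finished component of excess \<open>2 ^ i\<close>, and \<open>v\<close> in the majority of the
  current component, whose excess is \<open>d\<close>. Their colors determine all processed balls. Among these
  there are \<open>b\<close> green balls in any case (one in each discarded pair and, at the end, those found by
  comparison with a red ball), and besides them exactly the excess of each component with a green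
  majority; \<open>set_encode\<close> sums the powers \<open>2 ^ i\<close> over a set of exponents. Components already known to be red are invisible here: their excess contributes no
  green balls.
\<close>

definition knowledge ::
  "nat \<Rightarrow> nat \<Rightarrow> coloring set \<Rightarrow> nat \<Rightarrow> nat \<Rightarrow> (nat \<Rightarrow> nat) \<Rightarrow> nat \<Rightarrow> nat \<Rightarrow> nat \<Rightarrow> bool" where
  "knowledge N p S q j u b v d \<longleftrightarrow>
     q \<le> N \<and> v \<in> {1..q} \<and> (\<forall>c\<in>S. p_equal N p c) \<and>
     (\<forall>c\<in>S. \<forall>c'\<in>S. (\<forall>i<j. c (u i) = c' (u i)) \<longrightarrow> c v = c' v \<longrightarrow>
        (\<forall>x\<in>{1..q}. c x = c' x)) \<and>
     (\<forall>c\<in>S. greens q c =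
        b + set_encode {i. i < j \<and> c (u i) = Green} + (if c v = Green then d else 0))"

lemma color_eq_if_both_differ:
  fixes x y z :: color
  shows "x \<noteq> y \<Longrightarrow> z \<noteq> y \<Longrightarrow> x = z"
  by (cases x; cases y; cases z) auto

lemma knowledge_start:
  assumes "1 \<le> N"
  shows "knowledge N p {c. p_equal N p c} 1 0 u 0 1 1"
  using assms greens_Suc[of 0] by (simp add: knowledge_def greens_def)

text \<open>
  The common part of all steps that leave the finished components alone: processing the ball
  \<open>q + 1\<close> amounts to an update of the current representative, its excess and the number of certain
  green balls, together with a restriction of the possible colorings.
\<close>

lemma knowledge_extend:
  assumes K: "knowledge N p S q j u b v d" and "q < N" "S' \<subseteq> S" "v' \<in> {1..Suc q}"
    and determined: "\<And>c c'. c \<in> S' \<Longrightarrow> c' \<in> S' \<Longrightarrow> c v' = c' v' \<Longrightarrow>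
      c v = c' v \<and> c (Suc q) = c' (Suc q)"
    and count: "\<And>c. c \<in> S' \<Longrightarrow>
      b + (if c v = Green then d else 0) + (if c (Suc q) = Green then 1 else 0)
      = b' + (if c v' = Green then d' else 0)"
  shows "knowledge N p S' (Suc q) j u b' v' d'"
  unfolding knowledge_def
proof (intro conjI ballI impI)
  show "Suc q \<le> N" "v' \<in> {1..Suc q}" using assms(2,4) by auto
next
  fix c assume "c \<in> S'"
  then have "c \<in> S" using assms(3) by blast
  then show "p_equal N p c" using K by (simp add: knowledge_def)
  have "greens q c = b + set_encode {i. i < j \<and> c (u i) = Green} + (if c v = Green then d else 0)"
    using K \<open>c \<in> S\<close> unfolding knowledge_def by blast
  then show "greens (Suc q) c =
      b' + set_encode {i. i < j \<and> c (u i) = Green} + (if c v' = Green then d' else 0)"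
    using count[OF \<open>c \<in> S'\<close>] by (simp add: greens_Suc)
next
  fix c c' x
  assume c: "c \<in> S'" "c' \<in> S'" "\<forall>i<j. c (u i) = c' (u i)" "c v' = c' v'" and x: "x \<in> {1..Suc q}"
  have new: "c v = c' v" "c (Suc q) = c' (Suc q)" using determined[OF c(1,2,4)] by auto
  have "c \<in> S" "c' \<in> S" using c assms(3) by auto
  then have "\<forall>y\<in>{1..q}. c y = c' y" using K c(3) new(1) unfolding knowledge_def by blast
  then show "c x = c' x" using x new(2) by (cases "x = Suc q") auto
qed

lemma knowledge_in_range:
  "knowledge N p S q j u b v d \<Longrightarrow> v \<in> {1..q}"
  by (simp add: knowledge_def)

lemma solvable_compare_next:
  assumes K: "knowledge N p S q j u b v d" and "q < N"
    and "solvable N {c \<in> S. c v = c (Suc q)} k" "solvable N {c \<in> S. c v \<noteq> c (Suc q)} k"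
  shows "solvable N S (k + 1)"
proof (rule solvable_compare)
  show "v \<in> {1..N}" "Suc q \<in> {1..N}" "v \<noteq> Suc q"
    using knowledge_in_range[OF K] \<open>q < N\<close> by auto
qed (use assms(3,4) in simp_all)

lemma knowledge_same:
  assumes K: "knowledge N p S q j u b v d" and "q < N"
  shows "knowledge N p {c \<in> S. c v = c (Suc q)} (Suc q) j u b v (Suc d)"
  using knowledge_in_range[OF K] by (intro knowledge_extend[OF assms]) auto

text \<open>
  The new ball cancels one ball of the majority: whichever of the two colors is green, exactly one
  ball of this pair is green.
\<close>

lemma knowledge_diff:
  assumes K: "knowledge N p S q j u b v (Suc d)" and "q < N"
  shows "knowledge N p {c \<in> S. c v \<noteq> c (Suc q)} (Suc q) j u (Suc b) v d"
proof (rule knowledge_extend[OF assms])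
  show "v \<in> {1..Suc q}" using knowledge_in_range[OF K] by simp
next
  fix c c' assume "c \<in> {c \<in> S. c v \<noteq> c (Suc q)}" "c' \<in> {c \<in> S. c v \<noteq> c (Suc q)}" "c v = c' v"
  then show "c v = c' v \<and> c (Suc q) = c' (Suc q)"
    using color_eq_if_both_differ[of "c (Suc q)" "c v" "c' (Suc q)"] by auto
next
  fix c assume "c \<in> {c \<in> S. c v \<noteq> c (Suc q)}"
  then show "b + (if c v = Green then Suc d else 0) + (if c (Suc q) = Green then 1 else 0)
      = Suc b + (if c v = Green then d else 0)"
    by (cases "c v"; cases "c (Suc q)") auto
qed blast

text \<open>
  In a balanced component a new ball is in the majority whatever its color is, so on the answer
  ``different'' it has to become the representative.
\<close>

lemma knowledge_diff_balanced:
  assumes K: "knowledge N p S q j u b v 0" and "q < N"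
  shows "knowledge N p {c \<in> S. c v \<noteq> c (Suc q)} (Suc q) j u b (Suc q) 1"
proof (rule knowledge_extend[OF assms])
  fix c c' assume "c \<in> {c \<in> S. c v \<noteq> c (Suc q)}" "c' \<in> {c \<in> S. c v \<noteq> c (Suc q)}"
    "c (Suc q) = c' (Suc q)"
  then show "c v = c' v \<and> c (Suc q) = c' (Suc q)"
    using color_eq_if_both_differ[of "c v" "c (Suc q)" "c' v"] by auto
qed auto

text \<open>
  The current component is finished with its orientation left open, to be found by counting, and
  the next ball opens a component.
\<close>

lemma knowledge_keep:
  assumes K: "knowledge N p S q j u b v (2 ^ j)" and "q < N"
  shows "knowledge N p S (Suc q) (Suc j) (u(j := v)) b (Suc q) 1"
  unfolding knowledge_def
proof (intro conjI ballI impI)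
  fix c c' x
  assume "c \<in> S" "c' \<in> S" and reps: "\<forall>i<Suc j. c ((u(j := v)) i) = c' ((u(j := v)) i)"
    and "c (Suc q) = c' (Suc q)" "x \<in> {1..Suc q}"
  moreover have "\<forall>i<j. c (u i) = c' (u i)" "c v = c' v"
    using reps by (auto simp: less_Suc_eq split: if_splits)
  ultimately show "c x = c' x" using K unfolding knowledge_def by (auto simp: le_Suc_eq)
next
  fix c assume c: "c \<in> S"
  have "{i. i < Suc j \<and> c ((u(j := v)) i) = Green} =
    (if c v = Green then insert j {i. i < j \<and> c (u i) = Green} else {i. i < j \<and> c (u i) = Green})"
    by (auto simp: less_Suc_eq)
  then show "greens (Suc q) c = b + set_encode {i. i < Suc j \<and> c ((u(j := v)) i) = Green}
      + (if c (Suc q) = Green then 1 else 0)"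
    using K c unfolding knowledge_def by (simp add: greens_Suc)
qed (use assms in \<open>auto simp: knowledge_def\<close>)

lemma knowledge_majority_red:
  assumes K: "knowledge N p S q j u b v d" and "p < b + d" "c \<in> S"
  shows "c v = Red"
proof (rule ccontr)
  assume "c v \<noteq> Red"
  then have "c v = Green" by (cases "c v") auto
  then have "b + d \<le> greens q c" using K \<open>c \<in> S\<close> unfolding knowledge_def by simp
  also have "\<dots> \<le> greens N c" using K by (intro greens_mono) (simp add: knowledge_def)
  also have "\<dots> = p" using K \<open>c \<in> S\<close> unfolding knowledge_def p_equal_def greens_def by blast
  finally show False using assms(2) by simp
qed

text \<open>
  A component with a red majority needs no representative any more; the next ball opens a
  component.
\<close>

lemma knowledge_drop_red:
  assumes K: "knowledge N p S q j u b v d" and "q < N" and red: "\<forall>c\<in>S. c v = Red"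
  shows "knowledge N p S (Suc q) j u b (Suc q) 1"
proof (rule knowledge_extend[OF K \<open>q < N\<close>])
  fix c assume "c \<in> S"
  then have "c v = Red" using red by blast
  then show "b + (if c v = Green then d else 0) + (if c (Suc q) = Green then 1 else 0)
      = b + (if c (Suc q) = Green then 1 else 0)"
    by simp
next
  fix c c' assume "c \<in> S" "c' \<in> S" and new: "c (Suc q) = c' (Suc q)"
  then have "c v = Red" "c' v = Red" using red by blast+
  then show "c v = c' v \<and> c (Suc q) = c' (Suc q)" using new by simp
qed auto

section \<open>The three phases of the method\<close>

text \<open>
  Each remaining ball is compared with the red ball \<open>v\<close>. Then the number of green balls outside the
  excesses \<open>2 ^ i\<close> is known and their sum over the green-majority components is the rest of
  \<open>p\<close>, which determines these components by uniqueness of binary expansions. As \<open>v\<close> is red, the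
  summand with \<open>d\<close> vanishes, so \<open>d\<close> may stay fixed while balls are attached to \<open>v\<close>.
\<close>

lemma solvable_with_red_ball:
  assumes "knowledge N p S q j u b v d" and "\<forall>c\<in>S. c v = Red"
  shows "solvable N S (int N - int q)"
  using assms
proof (induction "N - q" arbitrary: S q b)
  case 0
  note K = 0(2)
  have q: "q = N" using 0(1) K by (simp add: knowledge_def)
  have "solvable N S 0"
  proof (rule solvable_if_determined)
    fix c c' i assume c: "c \<in> S" "c' \<in> S" and i: "i \<in> {1..N}"
    have count: "p = b + set_encode {i. i < j \<and> x (u i) = Green}" if x: "x \<in> S" for x
    proof -
      have "x v = Red" using 0(3) x by blast
      moreover have "greens N x = p"
        using K x unfolding knowledge_def p_equal_def greens_def by blast
      moreover have "greens N x = b + set_encode {i. i < j \<and> x (u i) = Green}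
          + (if x v = Green then d else 0)"
        using K x unfolding q knowledge_def by blast
      ultimately show ?thesis by simp
    qed
    have "set_encode {i. i < j \<and> c (u i) = Green} = set_encode {i. i < j \<and> c' (u i) = Green}"
      using count[OF c(1)] count[OF c(2)] by simp
    then have same: "{i. i < j \<and> c (u i) = Green} = {i. i < j \<and> c' (u i) = Green}"
      by (simp add: set_encode_eq)
    have "c (u i) = c' (u i)" if "i < j" for i
    proof -
      have "c (u i) = Green \<longleftrightarrow> c' (u i) = Green" using same that by blast
      then show ?thesis by (cases "c (u i)"; cases "c' (u i)") auto
    qed
    moreover have "c v = c' v"
    proof -
      have "c v = Red" "c' v = Red" using 0(3) c by blast+
      then show ?thesis by simp
    qed
    ultimately show "c i = c' i" using K c i unfolding q knowledge_def by blast
  qed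
  then show ?case using q by simp
next
  case (Suc n)
  note K = Suc.prems(1)
  have q: "q < N" "n = N - Suc q" using Suc.hyps(2) by auto
  have v: "v \<in> {1..q}" using K by (rule knowledge_in_range)
  have "knowledge N p {c \<in> S. c v = c (Suc q)} (Suc q) j u b v d"
  proof (rule knowledge_extend[OF K q(1)])
    fix c assume "c \<in> {c \<in> S. c v = c (Suc q)}"
    then have "c v = Red" "c (Suc q) = Red" using Suc.prems(2) by auto
    then show "b + (if c v = Green then d else 0) + (if c (Suc q) = Green then 1 else 0)
        = b + (if c v = Green then d else 0)"
      by simp
  qed (use v in auto)
  moreover have "knowledge N p {c \<in> S. c v \<noteq> c (Suc q)} (Suc q) j u (Suc b) v d"
  proof (rule knowledge_extend[OF K q(1)])
    fix c assume c: "c \<in> {c \<in> S. c v \<noteq> c (Suc q)}"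
    then have "c v = Red" using Suc.prems(2) by blast
    then show "b + (if c v = Green then d else 0) + (if c (Suc q) = Green then 1 else 0)
        = Suc b + (if c v = Green then d else 0)"
      using c by (cases "c (Suc q)") auto
  next
    fix c c' assume "c \<in> {c \<in> S. c v \<noteq> c (Suc q)}" "c' \<in> {c \<in> S. c v \<noteq> c (Suc q)}" "c v = c' v"
    then show "c v = c' v \<and> c (Suc q) = c' (Suc q)"
      using color_eq_if_both_differ[of "c (Suc q)" "c v" "c' (Suc q)"] by auto
  qed (use v in auto)
  moreover have "\<forall>c\<in>{c \<in> S. c v = c (Suc q)}. c v = Red"
    "\<forall>c\<in>{c \<in> S. c v \<noteq> c (Suc q)}. c v = Red"
    using Suc.prems(2) by blast+
  ultimately have "solvable N {c \<in> S. c v = c (Suc q)} (int N - int (Suc q))"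
    "solvable N {c \<in> S. c v \<noteq> c (Suc q)} (int N - int (Suc q))"
    using Suc.hyps(1) q(2) by blast+
  then have "solvable N S (int N - int (Suc q) + 1)" by (rule solvable_compare_next[OF K q(1)])
  then show ?case by simp
qed

text \<open>
  \<open>k\<close> counts the components, the current one included, that are still to be finished with a red
  majority; all but the current one save a comparison, as their first ball is not compared. With
  \<open>r = N - q\<close> unprocessed balls the hypothesis reads \<open>k \<le> (r + d - p') div (p' + 1)\<close>. An answer
  ``same'' preserves \<open>r + d\<close>, and so does any answer if \<open>d = 0\<close>. An answer ``different'' for \<open>d > 0\<close>
  lowers \<open>r + d\<close> by two and \<open>p'\<close> by one; then \<open>k * (p' + 1) + p'\<close>, which has to stay at most
  \<open>r + d\<close>, drops by \<open>k + 1 \<ge> 2\<close>. Finishing a component consumes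
  the excess \<open>p' + 1\<close>.
\<close>

lemma solvable_by_red_components:
  assumes "knowledge N p S q j u b v d" "b + p' = p" "d \<le> p' + 1"
    and "1 \<le> k" "k * (p' + 1) + p' + q \<le> N + d"
  shows "solvable N S (int N - int q + 1 - int k)"
  using assms
proof (induction "N - q" arbitrary: S q b v d p' k)
  case 0
  \<comment> \<open>Without unprocessed balls the size condition forces the current component to be just finished.\<close>
  have "1 * (p' + 1) \<le> k * (p' + 1)" using 0(5) by (rule mult_right_mono) simp
  then have p': "p' = 0" "d = 1" "k = 1" using 0 by (auto simp: knowledge_def)
  have "solvable N S (int N - int q)"
    using 0(2) by (rule solvable_with_red_ball) (use knowledge_majority_red[OF 0(2)] 0(3) p' in simp)
  then show ?case using p' by simp
next
  case (Suc n)
  note K = Suc.prems(1)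
  have q: "q < N" "n = N - Suc q" using Suc.hyps(2) by auto
  show ?case
  proof (cases "d = p' + 1")
    case True
    have red: "\<forall>c\<in>S. c v = Red"
      using knowledge_majority_red[OF K] True Suc.prems(2) by simp
    show ?thesis
    proof (cases "k = 1")
      case True
      then show ?thesis using solvable_with_red_ball[OF K red] by simp
    next
      case False
      then obtain l where l: "k = Suc l" "1 \<le> l" using Suc.prems(4) by (cases k) auto
      have "solvable N S (int N - int (Suc q) + 1 - int l)"
        using Suc.prems l True q
        by (intro Suc.hyps(1)[OF _ knowledge_drop_red[OF K _ red]]) auto
      then show ?thesis using l by (simp add: algebra_simps)
    qed
  next
    case False
    then have d: "d \<le> p'" using Suc.prems(3) by simp
    have same: "solvable N {c \<in> S. c v = c (Suc q)} (int N - int (Suc q) + 1 - int k)"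
      using Suc.prems d q by (intro Suc.hyps(1)[OF _ knowledge_same[OF K]]) auto
    have diff: "solvable N {c \<in> S. c v \<noteq> c (Suc q)} (int N - int (Suc q) + 1 - int k)"
    proof (cases d)
      case 0
      then show ?thesis
        using Suc.prems q knowledge_diff_balanced[of N p S q j u b v] by (intro Suc.hyps(1)) auto
    next
      case d': (Suc d')
      then obtain p'' where p'': "p' = Suc p''" using d by (cases p') auto
      have "k * (p'' + 1) + p'' + Suc q \<le> N + d'"
        using Suc.prems(4,5) unfolding d' p'' by simp
      then show ?thesis
        using Suc.prems q d d' p'' knowledge_diff[of N p S q j u b v d']
        by (intro Suc.hyps(1)[where p' = p'' and d = d' and b = "Suc b" and v = v]) auto
    qed
    have "solvable N S (int N - int (Suc q) + 1 - int k + 1)"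
      using same diff by (rule solvable_compare_next[OF K q(1)])
    then show ?thesis by (simp add: algebra_simps)
  qed
qed

text \<open>
  When the first phase stops after \<open>j\<close> components, the excess \<open>D - 2 ^ j\<close> has to provide one
  component of excess \<open>p' + 1\<close> for each of the \<open>m - j\<close> missing powers of two, in addition to the
  \<open>(D - 2 ^ m) div (p + 1)\<close> many promised for \<open>j = m\<close>. For \<open>j < m\<close> the phase can only have
  stopped because \<open>p' < 2 ^ j\<close>, so a component takes an excess of at most \<open>2 ^ j\<close>. The promised ones then
  fit into \<open>D - 2 ^ m\<close> because \<open>2 ^ j \<le> 2 ^ (m - 1) \<le> p\<close>, and the \<open>m - j\<close> others into
  \<open>2 ^ m - 2 ^ j\<close> because \<open>n + 1 \<le> 2 ^ n\<close>.
\<close>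

lemma red_components_suffice:
  fixes D m p j p' :: nat
  assumes "2 ^ m \<le> D" "2 ^ m \<le> 2 * p" "j \<le> m" "p' \<le> p"
    and stop: "D < 2 ^ Suc j \<or> p' < 2 ^ j"
  shows "(m - j + (D - 2 ^ m) div (p + 1)) * (p' + 1) + 2 ^ j \<le> D"
proof (cases "j = m")
  case True
  have "(D - 2 ^ m) div (p + 1) * (p' + 1) \<le> (D - 2 ^ m) div (p + 1) * (p + 1)"
    using assms(4) by (intro mult_left_mono) auto
  also have "\<dots> \<le> D - 2 ^ m" by (rule div_times_less_eq_dividend)
  finally show ?thesis using True assms(1) by simp
next
  case False
  then obtain n where n: "m = Suc (j + n)" using assms(3) less_imp_Suc_add[of j m] by auto
  define e where "e = (D - 2 ^ m) div (p + 1)"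
  have "(2::nat) ^ Suc j \<le> 2 ^ m" using n by (intro power_increasing) auto
  then have p': "p' + 1 \<le> 2 ^ j" using stop assms(1) by auto
  have "(2::nat) ^ j \<le> 2 ^ (j + n)" by (intro power_increasing) auto
  also have "\<dots> \<le> p + 1" using assms(2) unfolding n by simp
  finally have "e * 2 ^ j \<le> e * (p + 1)" by (intro mult_left_mono) auto
  also have "\<dots> \<le> D - 2 ^ m" unfolding e_def by (rule div_times_less_eq_dividend)
  finally have e: "e * 2 ^ j + 2 ^ m \<le> D" using assms(1) by linarith
  have "m - j + 1 \<le> 2 ^ Suc n" using less_exp[of "Suc n"] n by simp
  then have "(m - j + 1) * 2 ^ j \<le> 2 ^ Suc n * 2 ^ j" by (intro mult_right_mono) auto
  also have "\<dots> = 2 ^ m" unfolding n by (simp add: power_add)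
  finally have "(m - j) * 2 ^ j + 2 ^ j + e * 2 ^ j \<le> D" using e by (simp add: algebra_simps)
  moreover have "(m - j + e) * (p' + 1) \<le> (m - j + e) * 2 ^ j"
    using p' by (intro mult_left_mono) auto
  ultimately show ?thesis unfolding e_def by (simp add: algebra_simps)
qed

text \<open>
  The equation for \<open>q\<close> says that the processed balls are \<open>b\<close> pairs, finished components of excess
  \<open>1, 2, \<dots>, 2 ^ (j - 1)\<close>, which add up to \<open>2 ^ j - 1\<close>, and the current excess. The budget is what
  leads to \<open>T = m + 1 + (D - 2 ^ m) div (p + 1)\<close> components in the end when \<open>j + 1\<close> of them have
  been opened. The condition \<open>d \<le> p' + 1\<close> allows an unfinished component to be continued as the
  first one of the next phase, so that nothing is lost when \<open>p'\<close> drops below \<open>2 ^ j\<close>.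
\<close>

lemma solvable_by_power_components:
  assumes "knowledge N p S q j u b v d" "b + p' = p" "d \<le> p' + 1" "d \<le> 2 ^ j"
    and "q + 1 = 2 * b + 2 ^ j + d" "2 ^ j \<le> D" "j \<le> m"
    and N: "N = D + 2 * p" and m: "2 ^ m \<le> D" "2 ^ m \<le> 2 * p"
    and m_max: "\<And>l. 2 ^ l \<le> D \<Longrightarrow> 2 ^ l \<le> 2 * p \<Longrightarrow> l \<le> m"
  shows "solvable N S (int N - int q + int j - int m - int ((D - 2 ^ m) div (p + 1)))"
  using assms(1-7)
proof (induction "N - q" arbitrary: S q j u b v d p' rule: less_induct)
  case less
  note K = less.prems(1)
  show ?case
  proof (cases "2 ^ Suc j \<le> D \<and> 2 ^ j \<le> p'")
    case False
    \<comment> \<open>The number of red components still wanted, the current one included.\<close>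
    define k where "k = m - j + (D - 2 ^ m) div (p + 1) + 1"
    have "(m - j + (D - 2 ^ m) div (p + 1)) * (p' + 1) + 2 ^ j \<le> D"
      using False less.prems m by (intro red_components_suffice) auto
    then have "k * (p' + 1) + 2 ^ j \<le> D + p' + 1" unfolding k_def by (simp add: algebra_simps)
    then have "solvable N S (int N - int q + 1 - int k)"
      using less.prems N by (intro solvable_by_red_components[OF K, of p']) (auto simp: k_def)
    then show ?thesis using less.prems(7) by (simp add: k_def algebra_simps of_nat_diff)
  next
    case True
    then have q: "q < N" using less.prems N by simp
    show ?thesis
    proof (cases "d = 2 ^ j")
      case d: True
      have "Suc j \<le> m" using True less.prems(2) by (intro m_max) auto
      then have "solvable N S (int N - int (Suc q) + int (Suc j) - int m
          - int ((D - 2 ^ m) div (p + 1)))"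
        using True less.prems q d
        by (intro less.hyps[OF _ knowledge_keep[OF K[unfolded d] q]]) auto
      then show ?thesis by (simp add: algebra_simps)
    next
      case False
      then have d: "d < 2 ^ j" using less.prems(4) by simp
      define k where "k = int N - int (Suc q) + int j - int m - int ((D - 2 ^ m) div (p + 1))"
      have same: "solvable N {c \<in> S. c v = c (Suc q)} k"
        unfolding k_def using True less.prems q d
        by (intro less.hyps[OF _ knowledge_same[OF K q]]) auto
      have diff: "solvable N {c \<in> S. c v \<noteq> c (Suc q)} k"
      proof (cases d)
        case 0
        then show ?thesis
          unfolding k_def using True less.prems q knowledge_diff_balanced[of N p S q j u b v]
          by (intro less.hyps) auto
      next
        case d': (Suc d')
        then obtain p'' where p'': "p' = Suc p''" using d True by (cases p') auto
        show ?thesis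
          unfolding k_def
          using less.prems q d d' p'' True knowledge_diff[of N p S q j u b v d']
          by (intro less.hyps[where p' = p'' and d = d' and b = "Suc b" and v = v]) auto
      qed
      have "solvable N S (k + 1)" using same diff by (rule solvable_compare_next[OF K q])
      then show ?thesis by (simp add: k_def algebra_simps)
    qed
  qed
qed

section \<open>The upper bound\<close>

lemma p_equal_exists:
  assumes "p \<le> N"
  obtains c where "p_equal N p c"
proof
  have "{i \<in> {1..N}. (if i \<le> p then Green else Red) = Green} = {1..p}"
    using assms by auto
  then show "p_equal N p (\<lambda>i. if i \<le> p then Green else Red)"
    by (simp add: p_equal_def)
qed

lemma Q_equal_le_if_solvable:
  assumes "solvable N {c. p_equal N p c} k" "p \<le> N"
  shows "int (Q_equal N p) \<le> k"
proof -
  obtain t where t: "valid_strategy N t"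
    "\<And>c. p_equal N p c \<Longrightarrow>
      (\<forall>i\<in>{1..N}. announced t c i = c i) \<and> int (comparisons t c) \<le> k"
    using assms(1) unfolding solvable_def by auto
  have "0 \<le> k" using p_equal_exists[OF assms(2)] t(2) by (meson of_nat_0_le_iff order_trans)
  have "solves N p (nat k) t" using t unfolding solves_def by (auto simp: le_nat_iff[OF \<open>0 \<le> k\<close>])
  then have "Q_equal N p \<le> nat k" unfolding Q_equal_def by (intro Least_le) blast
  then show ?thesis using \<open>0 \<le> k\<close> by simp
qed

theorem theorem3:
  fixes N p m :: nat
  assumes "1 \<le> p" and "real p < real N / 2"
    and "2 ^ m \<le> min (N - 2 * p) (2 * p)"
    and "\<And>l :: nat. 2 ^ l \<le> min (N - 2 * p) (2 * p) \<Longrightarrow> l \<le> m"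
  shows "int (Q_equal N p) \<le>
    int N + 1 - int m - \<lfloor>(real N + 2 - 2 ^ m) / (real p + 1)\<rfloor>"
proof -
  define D where "D = N - 2 * p"
  have pN: "2 * p < N" using assms(2) by linarith
  then have N: "N = D + 2 * p" and D: "1 \<le> D" by (auto simp: D_def)
  have m: "2 ^ m \<le> D" "2 ^ m \<le> 2 * p" using assms(3) by (auto simp: D_def)
  \<comment> \<open>The first ball opens the first component, hence one processed ball and excess one.\<close>
  have "solvable N {c. p_equal N p c}
    (int N - int 1 + int 0 - int m - int ((D - 2 ^ m) div (p + 1)))"
    using N D m assms(4)
    by (intro solvable_by_power_components[OF knowledge_start[where u = id]]) (auto simp: D_def)
  then have "int (Q_equal N p) \<le> int N - 1 - int m - int ((D - 2 ^ m) div (p + 1))"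
    using pN by (intro Q_equal_le_if_solvable) auto
  moreover have "\<lfloor>(real N + 2 - 2 ^ m) / (real p + 1)\<rfloor> = int ((D - 2 ^ m) div (p + 1)) + 2"
  proof -
    have "(real N + 2 - 2 ^ m) / (real p + 1) = real (D - 2 ^ m) / real (p + 1) + 2"
      using m(1) by (simp add: N of_nat_diff field_simps)
    moreover have "\<lfloor>x + 2\<rfloor> = \<lfloor>x\<rfloor> + 2" for x :: real by linarith
    ultimately show ?thesis by (simp only: floor_divide_of_nat_eq)
  qed
  ultimately show ?thesis by simp
qed

end
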